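(* Let $(s,t)$ be one of the $14$ pairs listed in the context and let $z,a,b,c,k,j$ be real numbers with $-1\le z<1$, $z\ne0$, such that, as $x\to 0$, $$|z|^x \sum_{n=0}^{\infty} z^n\, \frac{(\frac12)_{n+x}(s)_{n+x}(t)_{n+x}(1-t)_{n+x}(1-s)_{n+x}}{(1)_{n+x}^5}\bigl(a+b(n+x)+c(n+x)^2\bigr)=\frac1{\pi^2}-\frac{k}{2}x^2+\frac{j}{24}\pi^2x^4+O(x^5).$$ Let $\tau$ be defined (up to sign) by $\tau^2=2m_0m_4-2m_1m_3+m_2^2$, with $m_0,\dots,m_4$ as in the context. If $z$ and $c$ are algebraic numbers, then $\tau$ is algebraic.
   Context: $(\alpha)_x=\Gamma(\alpha+x)/\Gamma(\alpha)$ denotes the generalized Pochhammer symbol. The admissible pairs $(s,t)$ are $(1/2,1/2)$, $(1/2,1/3)$, $(1/2,1/4)$, $(1/2,1/6)$, $(1/3,1/3)$, $(1/3,1/4)$, $(1/3,1/6)$, $(1/4,1/4)$, $(1/4,1/6)$, $(1/6,1/6)$, $(1/5,2/5)$, $(1/8,3/8)$, $(1/10,3/10)$, $(1/12,5/12)$. The numbers $m_0,\dots,m_4$ are the first Taylor coefficients at $x=0$: $$|z|^{-x}\,\frac{(1)_x^5}{(\frac12)_x(s)_x(t)_x(1-t)_x(1-s)_x}\left(\frac1{\pi^2}-\frac k2x^2+\frac{j}{24}\pi^2x^4\right)=m_0+m_1x+m_2x^2+m_3x^3+m_4x^4+O(x^5).$$ *)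

theory Defs
  imports "HOL-Analysis.Analysis" "HOL-Library.Landau_Symbols"
    "HOL-Computational_Algebra.Computational_Algebra"
begin

(* The library's pochhammer only allows a natural-number index. *)
definition gpoch :: "real \<Rightarrow> real \<Rightarrow> real" where
  "gpoch \<alpha> x = Gamma (\<alpha> + x) / Gamma \<alpha>"

definition admissible_pairs :: "(real \<times> real) set" where
  "admissible_pairs =
     {(1/2, 1/2), (1/2, 1/3), (1/2, 1/4), (1/2, 1/6), (1/3, 1/3), (1/3, 1/4), (1/3, 1/6),
      (1/4, 1/4), (1/4, 1/6), (1/6, 1/6), (1/5, 2/5), (1/8, 3/8), (1/10, 3/10), (1/12, 5/12)}"

definition hyp_coeff :: "real \<Rightarrow> real \<Rightarrow> real \<Rightarrow> real" where
  "hyp_coeff s t x =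
     gpoch (1/2) x * gpoch s x * gpoch t x * gpoch (1 - t) x * gpoch (1 - s) x / gpoch 1 x ^ 5"

(* For z = -1 and c nonzero the convergence is only conditional, so this has to be the
   ordered sum suminf rather than infsum. For -1 \<le> z < 1 the series converges
   for all x close to 0. *)
definition ramanujan_series ::
  "real \<Rightarrow> real \<Rightarrow> real \<Rightarrow> real \<Rightarrow> real \<Rightarrow> real \<Rightarrow> real \<Rightarrow> real" where
  "ramanujan_series s t z a b c x =
     \<bar>z\<bar> powr x *
     (\<Sum>n. z ^ n * hyp_coeff s t (real n + x) *
           (a + b * (real n + x) + c * (real n + x)\<^sup>2))"

definition rhs_poly :: "real \<Rightarrow> real \<Rightarrow> real \<Rightarrow> real" where
  "rhs_poly k j x = 1 / pi\<^sup>2 - k / 2 * x\<^sup>2 + j / 24 * pi\<^sup>2 * x ^ 4"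

definition m_fun :: "real \<Rightarrow> real \<Rightarrow> real \<Rightarrow> real \<Rightarrow> real \<Rightarrow> real \<Rightarrow> real" where
  "m_fun s t z k j x =
     \<bar>z\<bar> powr (- x) *
     (gpoch 1 x ^ 5 /
       (gpoch (1/2) x * gpoch s x * gpoch t x * gpoch (1 - t) x * gpoch (1 - s) x)) *
     rhs_poly k j x"

end

theory Submission
  imports Defs "HOL-Complex_Analysis.Complex_Analysis"
begin

text \<open>
  Dividing the expansion by $|z|^x (\frac12)_x (s)_x \cdots / (1)_x^5$ shows that $m_0, \dots, m_4$ are
  the first Taylor coefficients of $G(x) = \sum_n z^n g_n(x)$, where
  $g_n(x) = q(n+x) \prod_{i<n} P(i+x)/(i+1+x)^5$, $q(y) = a+by+cy^2$ and
  $P(y) = (y+\frac12)(y+s)(y+t)(y+1-t)(y+1-s)$. Hence $\tau^2$ is the coefficient of $x^4$ in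
  $G(x)G(-x)$. The coefficient of $z^N x^4$ in this product is
  $\sum_{n \le N} [x^4]\, g_n(x)g_{N-n}(-x)$, which is the sum of the residues at
  $y = 0, \dots, N$ of the rational function
  $q(y)q(N-y) \prod_{j=1}^N P(y-j) / \prod_{j=0}^N (y-j)^5$. This function behaves like
  $c^2/y$ at infinity, so every such coefficient equals $c^2$ and $\tau^2 = c^2/(1-z)$.
\<close>

subsection \<open>Algebraic numbers\<close>

text \<open>Linear algebra over the rationals takes the place of explicit minimal polynomials: being
  algebraic becomes a statement about the span of the powers.\<close>

interpretation rat_vs: vector_space "\<lambda>(r::rat) (x::'a::field_char_0). of_rat r * x"
  by unfold_locales (auto simp: algebra_simps of_rat_add of_rat_mult)

text \<open>One more power than there are spanning vectors cannot be independent over the rationals,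
  and a nontrivial relation between powers of x is a polynomial with root x.\<close>

lemma algebraic_if_powers_in_finite_span:
  fixes x :: "'a :: field_char_0"
  assumes fin: "finite B" and span: "\<And>n. x ^ n \<in> rat_vs.span B"
  shows "algebraic x"
\<comment> \<open>A repeated power is invisible in the set of powers, so coincidences are treated
  apart, by a difference of two monomials.\<close>
proof (cases "inj_on (\<lambda>n. x ^ n) {..card B}")
  case False
  then obtain m n where "m \<noteq> n" "x ^ m = x ^ n" by (auto simp: inj_on_def)
  then have "poly (monom 1 m - monom 1 n) x = 0" by (simp add: poly_monom)
  moreover have "(monom 1 m - monom 1 n :: 'a poly) \<noteq> 0"
    using \<open>m \<noteq> n\<close> by (auto simp: poly_eq_iff)
  moreover have "coeff (monom 1 m - monom 1 n :: 'a poly) i \<in> \<int>" for i by simp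
  ultimately show ?thesis by (intro algebraicI)
next
  case True
  define S where "S = (\<lambda>n. x ^ n) ` {..card B}"
  have "card S = Suc (card B)" using True by (simp add: S_def card_image)
  moreover have "S \<subseteq> rat_vs.span B" using span by (auto simp: S_def)
  ultimately have "rat_vs.dependent S"
    using rat_vs.independent_span_bound[OF fin, of S] by auto
  moreover have "finite S" by (simp add: S_def)
  ultimately obtain u v where v: "v \<in> S" "u v \<noteq> 0" and u: "(\<Sum>v\<in>S. of_rat (u v) * v) = 0"
    using rat_vs.dependent_finite by blast
  define p :: "'a poly" where "p = (\<Sum>n\<le>card B. monom (of_rat (u (x ^ n))) n)"
  have coeff: "coeff p i = (if i \<le> card B then of_rat (u (x ^ i)) else 0)" for i
    by (simp add: p_def coeff_sum)
  have "poly p x = (\<Sum>v\<in>S. of_rat (u v) * v)"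
    unfolding S_def using True by (simp add: p_def poly_sum poly_monom sum.reindex)
  then have "poly p x = 0" using u by simp
  moreover have "p \<noteq> 0"
  proof
    assume "p = 0"
    from v obtain n where n: "n \<le> card B" "u (x ^ n) \<noteq> 0" by (auto simp: S_def)
    with coeff[of n] show False by (simp add: \<open>p = 0\<close>)
  qed
  moreover have "coeff p i \<in> \<rat>" for i by (simp add: coeff)
  ultimately show ?thesis by (intro algebraicI')
qed

text \<open>An annihilating polynomial of degree d expresses \<open>x ^ d\<close> through lower
  powers; multiplying by \<open>x ^ (n - d)\<close> reduces every higher power in the same
  way.\<close>

lemma algebraic_powers_in_span:
  fixes x :: "'a :: field_char_0"
  assumes "algebraic x"
  obtains d where "\<And>n. x ^ n \<in> rat_vs.span ((\<lambda>i. x ^ i) ` {..<d})"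
proof -
  obtain p where p: "\<And>i. coeff p i \<in> \<rat>" "p \<noteq> 0" "poly p x = 0"
    using assms by (auto simp: algebraic_altdef)
  define d where "d = degree p"
  define V where "V = rat_vs.span ((\<lambda>i. x ^ i) ` {..<d})"
  have ratV: "r * v \<in> V" if "r \<in> \<rat>" "v \<in> V" for r v
    using that rat_vs.span_scale unfolding V_def by (auto elim!: Rats_cases)
  have "x ^ n \<in> V" for n
  proof (induction n rule: less_induct)
    case (less n)
    show ?case
    proof (cases "n < d")
      case True
      then show ?thesis unfolding V_def by (intro rat_vs.span_base) auto
    next
      case False
      have lead: "coeff p d \<noteq> 0" using p by (simp add: d_def)
      have "0 = poly p x" by (simp add: p)
      also have "\<dots> = (\<Sum>i<d. coeff p i * x ^ i) + coeff p d * x ^ d"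
        by (simp add: poly_altdef d_def lessThan_Suc_atMost[symmetric])
      finally have "x ^ d = (\<Sum>i<d. (- (coeff p i / coeff p d)) * x ^ i)"
        using lead by (simp add: field_simps sum_distrib_left eq_neg_iff_add_eq_0 sum_negf sum_divide_distrib[symmetric])
      moreover have "x ^ n = x ^ d * x ^ (n - d)" using False by (simp flip: power_add)
      ultimately have "x ^ n = (\<Sum>i<d. (- (coeff p i / coeff p d)) * x ^ (i + (n - d)))"
        by (simp add: sum_distrib_right power_add mult.assoc)
      moreover have "\<dots> \<in> V"
        unfolding V_def
      proof (intro rat_vs.span_sum, fold V_def)
        fix i assume "i \<in> {..<d}"
        then have "x ^ (i + (n - d)) \<in> V" using False by (intro less) auto
        then show "- (coeff p i / coeff p d) * x ^ (i + (n - d)) \<in> V"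
          by (intro ratV) (auto intro!: Rats_divide p(1))
      qed
      ultimately show ?thesis by simp
    qed
  qed
  then show ?thesis unfolding V_def by (rule that)
qed

text \<open>The finitely many products of a small power of x and a small power of y span all powers
  of x * y.\<close>

lemma algebraic_mult:
  fixes x y :: "'a :: field_char_0"
  assumes "algebraic x" "algebraic y"
  shows "algebraic (x * y)"
proof -
  obtain d where d: "\<And>n. x ^ n \<in> rat_vs.span ((\<lambda>i. x ^ i) ` {..<d})"
    using algebraic_powers_in_span[OF assms(1)] by blast
  obtain e where e: "\<And>n. y ^ n \<in> rat_vs.span ((\<lambda>i. y ^ i) ` {..<e})"
    using algebraic_powers_in_span[OF assms(2)] by blast
  define B where "B = (\<lambda>(i, j). x ^ i * y ^ j) ` ({..<d} \<times> {..<e})"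
  \<comment> \<open>Multiplication is bilinear, so it suffices to treat spanning vectors; the nested
    inductions do this for one argument after the other.\<close>
  have step: "v * w \<in> rat_vs.span B"
    if "v \<in> rat_vs.span ((\<lambda>i. x ^ i) ` {..<d})" "w \<in> rat_vs.span ((\<lambda>i. y ^ i) ` {..<e})" for v w
    using that(1)
  proof (induction rule: rat_vs.span_induct_alt)
    case base
    show ?case by (simp add: rat_vs.span_zero)
  next
    case (step r v v')
    then obtain i where i: "i < d" "v = x ^ i" by auto
    from that(2) have "v * w \<in> rat_vs.span B"
    proof (induction rule: rat_vs.span_induct_alt)
      case base
      show ?case by (simp add: rat_vs.span_zero)
    next
      case (step r' w w')
      then obtain j where "j < e" "w = y ^ j" by auto
      then have "v * w \<in> rat_vs.span B"
        using i by (intro rat_vs.span_base) (auto simp: B_def)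
      then have "of_rat r' * (v * w) + v * w' \<in> rat_vs.span B"
        using step by (intro rat_vs.span_add rat_vs.span_scale)
      then show ?case by (simp add: algebra_simps)
    qed
    then have "of_rat r * (v * w) + v' * w \<in> rat_vs.span B"
      using step by (intro rat_vs.span_add rat_vs.span_scale)
    then show ?case by (simp add: algebra_simps)
  qed
  show ?thesis
  proof (rule algebraic_if_powers_in_finite_span)
    show "finite B" by (simp add: B_def)
    show "(x * y) ^ n \<in> rat_vs.span B" for n
      unfolding power_mult_distrib by (rule step[OF d e])
  qed
qed

text \<open>Substituting 1 - X into an annihilating polynomial keeps its coefficients rational and
  moves the root x to 1 - x.\<close>

lemma algebraic_one_minus:
  fixes x :: "'a :: field_char_0"
  assumes "algebraic x"
  shows "algebraic (1 - x)"
proof -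
  obtain p where p: "\<And>i. coeff p i \<in> \<rat>" "p \<noteq> 0" "poly p x = 0"
    using assms by (auto simp: algebraic_altdef)
  let ?p = "pcompose p [:1, -1:]"
  have rat_mult: "\<forall>i. coeff (u * v) i \<in> \<rat>" if "\<forall>i. coeff u i \<in> \<rat>" "\<forall>i. coeff v i \<in> \<rat>" for u v :: "'a poly"
    using that by (auto simp: coeff_mult)
  have "\<forall>i. coeff ?p i \<in> \<rat>"
    using p(1)
  proof (induction p)
    case 0
    then show ?case by simp
  next
    case (pCons r p)
    have r: "r \<in> \<rat>" using pCons.prems[of 0] by simp
    have "coeff p i \<in> \<rat>" for i using pCons.prems[of "Suc i"] by simp
    then have "\<forall>i. coeff ([:1, -1:] * pcompose p [:1, -1:]) i \<in> \<rat>"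
      by (intro rat_mult pCons.IH) (auto simp: coeff_pCons split: nat.splits)
    with r show ?case
      unfolding pcompose_pCons by (auto simp: coeff_pCons split: nat.splits simp del: mult_pCons_left)
  qed
  moreover have "?p \<noteq> 0"
    using p(2) by (simp add: pcompose_eq_0_iff)
  moreover have "poly ?p (1 - x) = 0" using p(3) by (simp add: poly_pcompose)
  ultimately show ?thesis by (intro algebraicI'[of ?p]) auto
qed

subsection \<open>Residues and the convolution identity\<close>

text \<open>On a large circle f differs from L / y by o(1/|y|), so the two contour integrals, 2 pi i
  times the residue sum and 2 pi i L, are arbitrarily close. With half the distance as tolerance
  this already contradicts their being different.\<close>

lemma sum_residues_eq_limit_at_infinity:
  fixes f :: "complex \<Rightarrow> complex"
  assumes holo: "f holomorphic_on UNIV - A" and fin: "finite A"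
    and lim: "((\<lambda>y. y * f y) \<longlongrightarrow> L) at_infinity"
  shows "(\<Sum>p\<in>A. residue f p) = L"
proof (rule ccontr)
  define S where "S = (\<Sum>p\<in>A. residue f p)"
  assume "S \<noteq> L"
  then have "norm (S - L) / 2 > 0" by simp
  with lim have "eventually (\<lambda>y. norm (y * f y - L) < norm (S - L) / 2) at_infinity"
    unfolding tendsto_iff dist_norm by blast
  then obtain B where B: "\<And>y. norm y \<ge> B \<Longrightarrow> norm (y * f y - L) < norm (S - L) / 2"
    by (auto simp: eventually_at_infinity)
  have "bounded A" using fin by (rule finite_imp_bounded)
  then obtain r0 where r0: "\<And>p. p \<in> A \<Longrightarrow> norm p \<le> r0"
    by (auto simp: bounded_iff)
  \<comment> \<open>The circle has to avoid and enclose all of A, hence \<open>r0 + 1\<close>; the 1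
    keeps the radius positive when A is empty and r0 is arbitrary.\<close>
  define r where "r = max (max B (r0 + 1)) 1"
  have r: "r > 0" "r \<ge> B" "r > r0" by (auto simp: r_def)
  have "contour_integral (circlepath 0 r) f
      = 2 * pi * \<i> * (\<Sum>p\<in>A. winding_number (circlepath 0 r) p * residue f p)"
    using r r0 by (intro Residue_theorem[of UNIV]) (use holo fin in \<open>force\<close>)+
  also have "(\<Sum>p\<in>A. winding_number (circlepath 0 r) p * residue f p) = S"
    unfolding S_def using r r0
    by (intro sum.cong refl) (subst winding_number_circlepath, force+)
  finally have int1: "contour_integral (circlepath 0 r) f = 2 * pi * \<i> * S" .
  have "path_image (circlepath 0 r) \<subseteq> UNIV - A"
    using r r0 by force
  then have "f contour_integrable_on circlepath 0 r"
    using fin by (intro contour_integrable_holomorphic_simple[OF holo])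
      (auto intro!: open_Diff finite_imp_closed)
  then have int2: "(f has_contour_integral 2 * pi * \<i> * S) (circlepath 0 r)"
    using int1 has_contour_integral_integral by metis
  have "((\<lambda>w. 1 / (w - 0)) has_contour_integral 2 * pi * \<i>) (circlepath 0 r)"
    using contour_integral_circlepath[OF r(1), of 0] r(1)
      Cauchy_integral_circlepath_simple[of "\<lambda>_. 1" 0 r 0] by auto
  from has_contour_integral_lmul[OF this, of L] int2
  have "((\<lambda>w. f w - L * (1 / (w - 0))) has_contour_integral (2 * pi * \<i> * S - L * (2 * pi * \<i>)))
      (circlepath 0 r)"
    by (intro has_contour_integral_diff) auto
  then have "norm (2 * pi * \<i> * S - L * (2 * pi * \<i>)) \<le> norm (S - L) / 2 / r * (2 * pi * r)"
  proof (rule has_contour_integral_bound_circlepath)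
    fix w :: complex assume "norm (w - 0) = r"
    then have w: "norm w = r" by simp
    then have "w \<noteq> 0" using r by auto
    then have "f w - L * (1 / (w - 0)) = (w * f w - L) / w" by (simp add: field_simps)
    then have "norm (f w - L * (1 / (w - 0))) = norm (w * f w - L) / r"
      using w by (simp add: norm_divide)
    also have "\<dots> \<le> norm (S - L) / 2 / r"
      using B[of w] w r by (intro divide_right_mono) auto
    finally show "norm (f w - L * (1 / (w - 0))) \<le> norm (S - L) / 2 / r" .
  qed (use r in auto)
  also have "\<dots> = pi * norm (S - L)" using r by simp
  also have "2 * pi * \<i> * S - L * (2 * pi * \<i>) = 2 * pi * \<i> * (S - L)"
    by (simp add: algebra_simps)
  finally have "2 * pi * norm (S - L) \<le> pi * norm (S - L)"
    by (simp add: norm_mult)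
  then show False using \<open>S \<noteq> L\<close> by simp
qed

text \<open>The coefficient of x^4 in F(x) G(-x). For F = G with coefficients m0, ..., m4 it is 2 m0
  m4 - 2 m1 m3 + m2^2, the expression that defines tau^2.\<close>

definition alt_coeff4 :: "complex fps \<Rightarrow> complex fps \<Rightarrow> complex" where
  "alt_coeff4 F G = fps_nth (F * fps_compose G (- fps_X)) 4"

lemma alt_coeff4_eq:
  "alt_coeff4 F G = (\<Sum>i\<le>4. (-1) ^ i * (fps_nth F i * fps_nth G (4 - i)))"
  unfolding alt_coeff4_def fps_compose_uminus' fps_mult_nth
  by (rule sum.cong) (auto simp: minus_one_power_iff)

text \<open>The margin $1/20$ keeps every factor of $P(n+x)/(n+1+x)^5$ in the unit disc for $|x| \le 1/40$.\<close>

locale well_poised_term =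
  fixes s t :: real and a b c :: complex
  assumes s_bounds: "1/20 \<le> s" "s \<le> 19/20" and t_bounds: "1/20 \<le> t" "t \<le> 19/20"
begin

definition P :: "complex \<Rightarrow> complex" where
  "P y = (y + 1/2) * (y + of_real s) * (y + of_real t) * (y + 1 - of_real t) * (y + 1 - of_real s)"

definition q :: "complex \<Rightarrow> complex" where
  "q y = a + b * y + c * y\<^sup>2"

text \<open>The quotient of the hypergeometric coefficients at n + x and at x. Being rational in x,
  it frees the residue argument from Gamma functions.\<close>

definition R :: "nat \<Rightarrow> complex \<Rightarrow> complex" where
  "R n x = (\<Prod>i<n. P (of_nat i + x) / (of_nat i + 1 + x) ^ 5)"

definition g :: "nat \<Rightarrow> complex \<Rightarrow> complex" where
  "g n x = R n x * q (of_nat n + x)"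

text \<open>The parameters 1/2, s, t, 1 - t, 1 - s are stable under alpha -> 1 - alpha, so the
  reflection permutes the five linear factors up to sign, and five is odd.\<close>

lemma P_reflect: "P (- 1 - y) = - P y"
  by (simp add: P_def field_simps)

lemma P_holomorphic [holomorphic_intros]: 
  "f holomorphic_on A \<Longrightarrow> (\<lambda>x. P (f x)) holomorphic_on A"
  unfolding P_def by (intro holomorphic_intros)

lemma q_holomorphic [holomorphic_intros]: 
  "f holomorphic_on A \<Longrightarrow> (\<lambda>x. q (f x)) holomorphic_on A"
  unfolding q_def by (intro holomorphic_intros)

lemma of_nat_Suc_plus_nonzero:
  assumes "norm (x :: complex) < 1" shows "of_nat i + 1 + x \<noteq> 0"
proof
  assume "of_nat i + 1 + x = 0"
  then have "x = - of_nat (Suc i)" by (simp add: algebra_simps eq_neg_iff_add_eq_0)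
  then have "norm x = real (Suc i)" by (simp only: norm_minus_cancel norm_of_nat)
  with assms show False by simp
qed

lemma g_holomorphic: "g n holomorphic_on ball 0 1"
  unfolding g_def R_def
  by (intro holomorphic_intros) (use of_nat_Suc_plus_nonzero in auto)

lemma g_has_fps_expansion: "g n has_fps_expansion fps_expansion (g n) 0"
  by (rule has_fps_expansion_fps_expansion[of "ball 0 1"]) (auto intro: g_holomorphic)

text \<open>
  Up to the factor $(y-n)^{-5}$, the products $g_n(x)\,g_{N-n}(-x)$ for $0 \le n \le N$ are all one
  rational function of $y = n + x$; this relies on $P(-1-y) = -P(y)$.
\<close>

definition \<Phi> :: "nat \<Rightarrow> complex \<Rightarrow> complex" where
  "\<Phi> N y = q y * q (of_nat N - y) * (\<Prod>j=1..N. P (y - of_nat j)) / (\<Prod>j=0..N. (y - of_nat j) ^ 5)"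

lemma R_shift:
  "R n (y - of_nat n) = (\<Prod>j=1..n. P (y - of_nat j)) / (\<Prod>j=0..<n. (y - of_nat j) ^ 5)"
proof -
  have "(\<Prod>i<n. P (of_nat i + (y - of_nat n))) = (\<Prod>j=1..n. P (y - of_nat j))"
    by (rule prod.reindex_bij_witness[of _ "\<lambda>j. n - j" "\<lambda>i. n - i"])
       (auto simp: of_nat_diff algebra_simps)
  moreover have "(\<Prod>i<n. (of_nat i + 1 + (y - of_nat n)) ^ 5) = (\<Prod>j=0..<n. (y - of_nat j) ^ 5)"
    by (rule prod.reindex_bij_witness[of _ "\<lambda>j. n - 1 - j" "\<lambda>i. n - 1 - i"])
       (auto simp: of_nat_diff algebra_simps Suc_le_eq)
  ultimately show ?thesis by (simp add: R_def prod_dividef)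
qed

text \<open>With j = n + 1 + i, the i-th factor has its numerator reflected by
  \<open>P_reflect\<close> and its denominator negated to an odd power; the two signs
  cancel.\<close>

lemma R_reflect:
  assumes "n \<le> N"
  shows "R (N - n) (of_nat n - y)
    = (\<Prod>j=Suc n..N. P (y - of_nat j)) / (\<Prod>j=Suc n..N. (y - of_nat j) ^ 5)"
proof -
  have "R (N - n) (of_nat n - y) = (\<Prod>j=Suc n..N. P (y - of_nat j) / (y - of_nat j) ^ 5)"
    unfolding R_def
  proof (rule prod.reindex_bij_witness[of _ "\<lambda>j. j - Suc n" "\<lambda>i. Suc n + i"], goal_cases)
    case (5 i)
    have 1: "of_nat i + (of_nat n - y) = - 1 - (y - of_nat (Suc n + i))" by simp
    have 2: "of_nat i + 1 + (of_nat n - y) = - (y - of_nat (Suc n + i))" by simp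
    have 3: "(- w) ^ 5 = - (w ^ 5)" for w :: complex by simp
    show ?case unfolding 1 2 3 P_reflect by (simp only: minus_divide_divide)
  qed (use assms in auto)
  then show ?thesis by (simp add: prod_dividef)
qed

text \<open>\<open>R_shift\<close> supplies the numerator factors up to n and
  \<open>R_reflect\<close> those above n. Their denominators omit exactly j = n, which leaves the
  fifth power of y - n.\<close>

lemma \<Phi>_local:
  assumes "n \<le> N"
  shows "\<Phi> N y = g n (y - of_nat n) * g (N - n) (- (y - of_nat n)) / (y - of_nat n) ^ Suc 4"
proof -
  have "{1..N} = {1..n} \<union> {Suc n..N}" using assms by auto
  then have 1: "(\<Prod>j=1..N. P (y - of_nat j)) = (\<Prod>j=1..n. P (y - of_nat j)) * (\<Prod>j=Suc n..N. P (y - of_nat j))"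
    by (simp only:) (rule prod.union_disjoint, auto)
  have "{0..N} = insert n ({0..<n} \<union> {Suc n..N})" using assms by auto
  then have 2: "(\<Prod>j=0..N. (y - of_nat j) ^ 5) = (y - of_nat n) ^ 5 *
      ((\<Prod>j=0..<n. (y - of_nat j) ^ 5) * (\<Prod>j=Suc n..N. (y - of_nat j) ^ 5))"
    by (simp only:) (subst prod.insert, auto intro!: prod.union_disjoint)
  have 3: "of_nat (N - n) + - (y - of_nat n) = of_nat N - y" using assms by (simp add: of_nat_diff)
  have 4: "- (y - of_nat n) = of_nat n - y" by simp
  have 5: "of_nat n + (y - of_nat n) = y" by simp
  show ?thesis
    unfolding \<Phi>_def g_def 3 5 unfolding 1 2 4 R_shift R_reflect[OF assms]
    by (simp add: mult_ac)
qed

text \<open>Around y = n the function is a power series in x = y - n divided by x^5, so its residue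
  is the coefficient of x^4.\<close>

lemma residue_\<Phi>:
  assumes "n \<le> N"
  shows "residue (\<Phi> N) (of_nat n) = alt_coeff4 (fps_expansion (g n) 0) (fps_expansion (g (N - n)) 0)"
proof -
  have exp: "(\<lambda>x. g n x * (g (N - n) \<circ> (\<lambda>x. - x)) x) has_fps_expansion
      fps_expansion (g n) 0 * fps_compose (fps_expansion (g (N - n)) 0) (- fps_X)"
    by (intro fps_expansion_intros g_has_fps_expansion) auto
  have "residue (\<Phi> N) (of_nat n) = residue (\<lambda>x. \<Phi> N (of_nat n + x)) 0"
    by (rule residue_shift_0)
  also have "(\<lambda>x. \<Phi> N (of_nat n + x)) = (\<lambda>x. (g n x * (g (N - n) \<circ> (\<lambda>x. - x)) x) / x ^ Suc 4)"
    by (rule ext, subst \<Phi>_local[OF assms]) (simp add: o_def)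
  also have "residue \<dots> 0 =
      fps_nth (fps_expansion (g n) 0 * fps_compose (fps_expansion (g (N - n)) 0) (- fps_X)) 4"
    by (rule residue_fps_expansion_over_power_at_0[OF exp])
  finally show ?thesis by (simp add: alt_coeff4_def)
qed

text \<open>Both q factors grow at most like y^2 with coefficient c of y^2, and P(y) ~ y^5.
  Numerator and denominator have degrees at most 4 + 5N and exactly 5N + 5, so the limit is c^2
  whatever N is.\<close>

lemma \<Phi>_limit: "((\<lambda>y. y * \<Phi> N y) \<longlongrightarrow> c\<^sup>2) at_infinity"
proof -
  have inv: "((\<lambda>y::complex. 1 / y) \<longlongrightarrow> 0) at_infinity"
    using tendsto_inverse_0 by (simp add: inverse_eq_divide[abs_def])
  have shift: "filterlim (\<lambda>y::complex. y - of_nat j) at_infinity at_infinity" for j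
    using tendsto_add_filterlim_at_infinity[OF tendsto_const[of "- of_nat j"] filterlim_ident]
    by (simp add: algebra_simps)
  have P: "((\<lambda>y. P y / y ^ 5) \<longlongrightarrow> 1) at_infinity"
  proof -
    have fac: "((\<lambda>y. 1 + e * (1/y)) \<longlongrightarrow> 1) at_infinity" for e :: complex
      using tendsto_add[OF tendsto_const tendsto_mult[OF tendsto_const inv], of 1 e] by simp
    let ?L = "\<lambda>y::complex. (1 + 1/2 * (1/y)) * (1 + of_real s * (1/y)) * (1 + of_real t * (1/y)) *
       (1 + (1 - of_real t) * (1/y)) * (1 + (1 - of_real s) * (1/y))"
    have "(?L \<longlongrightarrow> 1 * 1 * 1 * 1 * 1) at_infinity"
      by (intro tendsto_mult fac)
    then have "(?L \<longlongrightarrow> 1) at_infinity" by simp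
    moreover have "eventually (\<lambda>y. ?L y = P y / y ^ 5) at_infinity"
      using eventually_not_equal_at_infinity[of 0]
    proof eventually_elim
      case (elim y)
      have fac: "y * (1 + e * (1/y)) = y + e" for e
        using elim by (simp add: field_simps)
      have "P y = (y * (1 + 1/2 * (1/y))) * (y * (1 + of_real s * (1/y))) *
          (y * (1 + of_real t * (1/y))) * (y * (1 + (1 - of_real t) * (1/y))) *
          (y * (1 + (1 - of_real s) * (1/y)))"
        unfolding P_def fac by (simp only: add_diff_eq)
      also have "\<dots> = (y * y * y * y * y) * ?L y"
        by (simp only: mult_ac)
      also have "y * y * y * y * y = y ^ 5" by (simp add: eval_nat_numeral)
      finally show ?case using elim by simp
    qed
    ultimately show ?thesis by (rule Lim_transform_eventually)
  qed
  have Q: "((\<lambda>y. q y * q (of_nat N - y) / y ^ 4) \<longlongrightarrow> c\<^sup>2) at_infinity"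
  proof -
    let ?u = "\<lambda>y. a * (1/y) * (1/y) + b * (1/y) + c"
    let ?v = "\<lambda>y. a * (1/y) * (1/y) + b * (of_nat N * (1/y) - 1) * (1/y) + c * (of_nat N * (1/y) - 1)\<^sup>2"
    have "((\<lambda>y. ?u y * ?v y) \<longlongrightarrow> (a * 0 * 0 + b * 0 + c) *
        (a * 0 * 0 + b * (of_nat N * 0 - 1) * 0 + c * (of_nat N * 0 - 1)\<^sup>2)) at_infinity"
      by (intro tendsto_intros inv)
    then have "((\<lambda>y. ?u y * ?v y) \<longlongrightarrow> c\<^sup>2) at_infinity"
      by (simp add: power2_eq_square)
    moreover have "eventually (\<lambda>y. ?u y * ?v y = q y * q (of_nat N - y) / y ^ 4) at_infinity"
      using eventually_not_equal_at_infinity[of 0]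
    proof eventually_elim
      case (elim y)
      have "q y = y\<^sup>2 * ?u y"
        unfolding q_def using elim by (simp add: field_simps power2_eq_square)
      moreover have "q (of_nat N - y) = y\<^sup>2 * ?v y"
        unfolding q_def using elim by (simp add: field_simps power2_eq_square)
      moreover have "y ^ 4 = y\<^sup>2 * y\<^sup>2" by (simp flip: power_add)
      ultimately have "q y * q (of_nat N - y) = y ^ 4 * (?u y * ?v y)"
        by (simp only: mult_ac)
      then show ?case using elim by simp
    qed
    ultimately show ?thesis by (rule Lim_transform_eventually)
  qed
  \<comment> \<open>The j = 0 factor y^5 of the denominator splits as y * y^4: the y cancels the
    prefactor, and the y^4 normalises the two q factors.\<close>
  let ?f = "\<lambda>y. (q y * q (of_nat N - y) / y ^ 4) * (\<Prod>j=1..N. P (y - of_nat j) / (y - of_nat j) ^ 5)"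
  have "(?f \<longlongrightarrow> c\<^sup>2 * (\<Prod>j=1..N. 1)) at_infinity"
    by (intro tendsto_intros Q filterlim_compose[OF P shift])
  then have "(?f \<longlongrightarrow> c\<^sup>2) at_infinity" by simp
  moreover have "eventually (\<lambda>y. ?f y = y * \<Phi> N y) at_infinity"
    using eventually_not_equal_at_infinity[of 0]
  proof eventually_elim
    case (elim y)
    have "(\<Prod>j=0..N. (y - of_nat j) ^ 5) = y ^ 5 * (\<Prod>j=1..N. (y - of_nat j) ^ 5)"
      by (subst prod.atLeast_Suc_atMost) auto
    moreover have "y ^ 5 = y * y ^ 4" by (simp flip: power_Suc)
    ultimately show ?case using elim by (simp add: \<Phi>_def prod_dividef)
  qed
  ultimately show ?thesis by (rule Lim_transform_eventually)
qed

lemma \<Phi>_holomorphic: "\<Phi> N holomorphic_on UNIV - of_nat ` {0..N}"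
  unfolding \<Phi>_def by (intro holomorphic_intros) auto

text \<open>All possible poles lie in 0, ..., N, so the sum is a complete sum of residues. Its
  independence of N makes the generating function in \<open>alt_coeff4_H\<close> a geometric
  series.\<close>

lemma convolution_g:
  "(\<Sum>n\<le>N. alt_coeff4 (fps_expansion (g n) 0) (fps_expansion (g (N - n)) 0)) = c\<^sup>2"
proof -
  have "(\<Sum>n\<le>N. alt_coeff4 (fps_expansion (g n) 0) (fps_expansion (g (N - n)) 0))
      = (\<Sum>p\<in>of_nat ` {0..N}. residue (\<Phi> N) p)"
    by (subst sum.reindex) (auto simp: inj_on_def residue_\<Phi> atLeast0AtMost)
  also have "\<dots> = c\<^sup>2"
    by (intro sum_residues_eq_limit_at_infinity \<Phi>_holomorphic \<Phi>_limit) auto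
  finally show ?thesis .
qed

end

subsection \<open>Bounds and convergence\<close>

definition well_poised_ratio :: "real \<Rightarrow> nat \<Rightarrow> complex \<Rightarrow> complex" where
  "well_poised_ratio \<alpha> i x = (of_nat i + of_real \<alpha> + x) / (of_nat i + 1 + x)"

lemma norm_denominator_ge:
  assumes "norm (x :: complex) \<le> 1/40"
  shows "real i + 39/40 \<le> norm (of_nat i + 1 + x)"
proof -
  have "norm (of_nat (Suc i) :: complex) - norm x \<le> norm (of_nat (Suc i) + x)"
    by (rule norm_diff_ineq)
  then have "real (Suc i) - norm x \<le> norm (of_nat (Suc i) + x)" by (simp only: norm_of_nat)
  moreover have "of_nat (Suc i) + x = of_nat i + 1 + x" by simp
  ultimately have "real (Suc i) - norm x \<le> norm (of_nat i + 1 + x)" by (simp only:)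
  then show ?thesis using assms by simp
qed

lemma norm_well_poised_ratio_le:
  assumes x: "norm x \<le> 1/40" and "0 \<le> \<alpha>"
  shows "norm (well_poised_ratio \<alpha> i x) \<le> exp (- (19/20 - \<alpha>) / (real i + 39/40))"
proof -
  have "norm (of_nat i + complex_of_real \<alpha> + x) \<le> real i + \<alpha> + 1/40"
    by (intro norm_triangle_le add_mono) (use assms in auto)
  then have "norm (well_poised_ratio \<alpha> i x) \<le> (real i + \<alpha> + 1/40) / (real i + 39/40)"
    unfolding well_poised_ratio_def norm_divide
    using norm_denominator_ge[OF x, of i] assms by (intro frac_le) auto
  \<comment> \<open>19/20 is 39/40 - 1/40: the denominator bound loses 1/40 and the numerator bound
    gains 1/40.\<close>
  also have "\<dots> = 1 + (- (19/20 - \<alpha>) / (real i + 39/40))"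
    by (simp add: field_simps)
  also have "\<dots> \<le> exp (- (19/20 - \<alpha>) / (real i + 39/40))"
    by (rule exp_ge_add_one_self)
  finally show ?thesis .
qed

lemma norm_well_poised_ratio_le_1:
  assumes "norm x \<le> 1/40" "0 \<le> \<alpha>" "\<alpha> \<le> 19/20"
  shows "norm (well_poised_ratio \<alpha> i x) \<le> 1"
proof -
  have "exp (- (19/20 - \<alpha>) / (real i + 39/40)) \<le> 1"
    using assms by (simp add: divide_nonpos_pos)
  then show ?thesis using norm_well_poised_ratio_le[OF assms(1,2), of i] by linarith
qed

lemma norm_well_poised_ratio_diff_1:
  assumes x: "norm x \<le> 1/40" and "0 \<le> \<alpha>" "\<alpha> \<le> 1"
  shows "norm (well_poised_ratio \<alpha> i x - 1) \<le> 2 / (real i + 1)"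
proof -
  have d: "real i + 39/40 \<le> norm (of_nat i + 1 + x)" by (rule norm_denominator_ge[OF x])
  then have "of_nat i + 1 + x \<noteq> 0" by auto
  then have "well_poised_ratio \<alpha> i x - 1 = of_real (\<alpha> - 1) / (of_nat i + 1 + x)"
    by (simp add: well_poised_ratio_def field_simps)
  then have "norm (well_poised_ratio \<alpha> i x - 1) = \<bar>\<alpha> - 1\<bar> / norm (of_nat i + 1 + x)"
    by (simp only: norm_divide norm_of_real)
  also have "\<dots> \<le> 1 / (real i + 39/40)"
    using d assms by (intro frac_le) auto
  also have "\<dots> \<le> 2 / (real i + 1)" by (simp add: field_simps)
  finally show ?thesis .
qed

text \<open>From uv - 1 = (u - 1) + u(v - 1). Iterated, it bounds the distance from 1 of a product
  of factors in the unit disc by the sum of their distances.\<close>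

lemma norm_mult_diff_1:
  fixes u v :: complex
  assumes "norm u \<le> 1" "norm (u - 1) \<le> A" "norm (v - 1) \<le> B"
  shows "norm (u * v - 1) \<le> A + B"
proof -
  have "u * v - 1 = (u - 1) + u * (v - 1)" by (simp add: algebra_simps)
  also have "norm \<dots> \<le> norm (u - 1) + norm u * norm (v - 1)"
    using norm_triangle_ineq[of "u - 1" "u * (v - 1)"] by (simp add: norm_mult)
  also have "norm u * norm (v - 1) \<le> 1 * B" by (rule mult_mono) (use assms in auto)
  finally show ?thesis using assms by simp
qed

section \<open>Decay of the terms and of their differences near x = 0\<close>

context well_poised_term
begin

lemma P_ratio:
  "P (of_nat i + x) / (of_nat i + 1 + x) ^ 5 =
   well_poised_ratio (1/2) i x * (well_poised_ratio s i x * (well_poised_ratio t i x *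
   (well_poised_ratio (1 - t) i x * well_poised_ratio (1 - s) i x)))"
proof -
  have "(of_nat i + 1 + x) ^ 5 = (of_nat i + 1 + x) * ((of_nat i + 1 + x) * ((of_nat i + 1 + x) *
    ((of_nat i + 1 + x) * (of_nat i + 1 + x))))"
    by (simp add: eval_nat_numeral)
  moreover have "of_nat i + x + e = of_nat i + e + x" "of_nat i + x + 1 - e = of_nat i + (1 - e) + x" for e
    by (simp_all add: algebra_simps)
  ultimately show ?thesis
    unfolding P_def well_poised_ratio_def times_divide_times_eq
    by (simp only: mult.assoc of_real_diff of_real_1 of_real_divide of_real_numeral)
qed

text \<open>
  Since the parameters $1/2, s, t, 1-t, 1-s$ add up to $5/2$, the five factors contribute the
  exponent $5 \cdot 19/20 - 5/2 = 9/4$.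
\<close>

lemma norm_P_ratio_le:
  assumes x: "norm x \<le> 1/40"
  shows "norm (P (of_nat i + x) / (of_nat i + 1 + x) ^ 5) \<le> exp (- (9/4) / (real i + 1))"
proof -
  let ?e = "\<lambda>\<alpha>. - (19/20 - \<alpha>) / (real i + 39/40)"
  have "norm (P (of_nat i + x) / (of_nat i + 1 + x) ^ 5)
     \<le> exp (?e (1/2)) * (exp (?e s) * (exp (?e t) * (exp (?e (1 - t)) * exp (?e (1 - s)))))"
    unfolding P_ratio norm_mult
    by (intro mult_mono norm_well_poised_ratio_le mult_nonneg_nonneg x) (use s_bounds t_bounds in auto)
  also have "\<dots> = exp (?e (1/2) + (?e s + (?e t + (?e (1 - t) + ?e (1 - s)))))"
    by (simp only: exp_add)
  also have "?e (1/2) + (?e s + (?e t + (?e (1 - t) + ?e (1 - s)))) = - (9/4) / (real i + 39/40)"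
    by (simp only: add_divide_distrib[symmetric]) (simp add: algebra_simps)
  also have "exp \<dots> \<le> exp (- (9/4) / (real i + 1))" by (simp add: field_simps)
  finally show ?thesis .
qed

lemma norm_P_ratio_diff_1:
  assumes x: "norm x \<le> 1/40"
  shows "norm (P (of_nat i + x) / (of_nat i + 1 + x) ^ 5 - 1) \<le> 10 / (real i + 1)"
proof -
  let ?A = "2 / (real i + 1)"
  have "norm (P (of_nat i + x) / (of_nat i + 1 + x) ^ 5 - 1) \<le> ?A + (?A + (?A + (?A + ?A)))"
    unfolding P_ratio
    by (intro norm_mult_diff_1 norm_well_poised_ratio_le_1 norm_well_poised_ratio_diff_1 x)
      (use s_bounds t_bounds in auto)
  also have "?A + (?A + (?A + (?A + ?A))) = 10 / (real i + 1)"
    by (simp only: add_divide_distrib[symmetric]) simp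
  finally show ?thesis .
qed

lemma R_Suc: "R (Suc n) x = R n x * (P (of_nat n + x) / (of_nat n + 1 + x) ^ 5)"
  by (simp add: R_def)

text \<open>The exponents of \<open>norm_P_ratio_le\<close> add up to a harmonic sum, which
  dominates the logarithm; the induction step is ln(1 + 1/(n+1)) <= 1/(n+1).\<close>

lemma norm_R_le:
  assumes x: "norm x \<le> 1/40"
  shows "norm (R n x) \<le> real (Suc n) powr (- 9/4)"
proof (induction n)
  case 0
  show ?case by (simp add: R_def)
next
  case (Suc n)
  have "norm (R (Suc n) x) \<le> real (Suc n) powr (- 9/4) * exp (- (9/4) / (real n + 1))"
    unfolding R_Suc norm_mult by (intro mult_mono Suc norm_P_ratio_le x) auto
  also have "\<dots> = exp (- 9/4 * (ln (real (Suc n)) + 1 / real (Suc n)))"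
    by (simp add: powr_def exp_add[symmetric] algebra_simps)
  also have "\<dots> \<le> exp (- 9/4 * ln (real (Suc (Suc n))))"
  proof -
    have "real (Suc (Suc n)) = real (Suc n) + 1" by simp
    also have "\<dots> = real (Suc n) * (1 + 1 / real (Suc n))"
      by (simp add: distrib_left del: of_nat_Suc)
    finally have "ln (real (Suc (Suc n))) = ln (real (Suc n) * (1 + 1 / real (Suc n)))"
      by (simp only:)
    also have "\<dots> = ln (real (Suc n)) + ln (1 + 1 / real (Suc n))"
      by (rule ln_mult_pos) (auto intro: add_pos_nonneg)
    also have "ln (1 + 1 / real (Suc n)) \<le> 1 / real (Suc n)"
      by (rule ln_add_one_self_le_self) auto
    finally show ?thesis by simp
  qed
  also have "\<dots> = real (Suc (Suc n)) powr (- 9/4)" by (simp add: powr_def)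
  finally show ?case .
qed

definition K :: real where "K = norm a + norm b + norm c"

lemma norm_q_le:
  assumes "norm y \<le> r" "1 \<le> r"
  shows "norm (q y) \<le> K * r\<^sup>2"
proof -
  have r2: "r \<le> r\<^sup>2" "1 \<le> r\<^sup>2" using assms by (auto simp: power2_eq_square mult_ge1_I)
  have "norm (q y) \<le> norm a + norm b * norm y + norm c * (norm y)\<^sup>2"
    unfolding q_def by (intro norm_triangle_le add_mono) (auto simp: norm_mult norm_power)
  also have "\<dots> \<le> norm a * r\<^sup>2 + norm b * r\<^sup>2 + norm c * r\<^sup>2"
    using r2 assms by (intro add_mono mult_left_mono power_mono) (auto simp: mult_le_cancel_left1)
  finally show ?thesis by (simp add: K_def algebra_simps)
qed

lemma norm_of_nat_plus_le:
  assumes "norm (x :: complex) \<le> 1/40"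
  shows "norm (of_nat n + x) \<le> real (Suc n)"
  by (rule norm_triangle_le) (use assms in auto)

text \<open>The exponent -9/4 of R outweighs the quadratic growth of q by 1/4: enough for terms
  tending to 0, not for summability.\<close>

lemma norm_g_le:
  assumes x: "norm x \<le> 1/40"
  shows "norm (g n x) \<le> K * real (Suc n) powr (- 1/4)"
proof -
  have "norm (g n x) \<le> real (Suc n) powr (- 9/4) * (K * (real (Suc n))\<^sup>2)"
    unfolding g_def norm_mult
    by (intro mult_mono norm_R_le norm_q_le norm_of_nat_plus_le x) auto
  also have "(real (Suc n))\<^sup>2 = real (Suc n) powr 2" by (rule powr_numeral[symmetric]) simp
  also have "real (Suc n) powr (- 9/4) * (K * real (Suc n) powr 2)
    = K * (real (Suc n) powr (- 9/4) * real (Suc n) powr 2)" by simp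
  also have "real (Suc n) powr (- 9/4) * real (Suc n) powr 2 = real (Suc n) powr (- 1/4)"
    by (simp only: powr_add[symmetric]) simp
  finally show ?thesis .
qed

lemma g_tendsto_0:
  assumes x: "norm x \<le> 1/40"
  shows "(\<lambda>n. g n x) \<longlonglongrightarrow> 0"
proof (rule Lim_null_comparison)
  show "\<forall>\<^sub>F n in sequentially. norm (g n x) \<le> K * real (Suc n) powr (- 1/4)"
    using norm_g_le[OF x] by simp
  have "(\<lambda>n. real (Suc n) powr (- (1/4))) \<longlonglongrightarrow> 0"
    by (rule tendsto_neg_powr[OF _ filterlim_compose[OF filterlim_real_sequentially filterlim_Suc]])
      simp
  then show "(\<lambda>n. K * real (Suc n) powr (- 1/4)) \<longlonglongrightarrow> 0"
    by (intro tendsto_mult_right_zero) simp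
qed

text \<open>
  $g_n$ decays only like $n^{-1/2}$, so that $\sum z^n g_n$ need not converge absolutely for $z = -1$.
  Its product with $1 - z$ is $\sum z^n h_n$, which does, and uniformly near $x = 0$.
\<close>

definition h :: "nat \<Rightarrow> complex \<Rightarrow> complex" where
  "h n x = (case n of 0 \<Rightarrow> g 0 x | Suc m \<Rightarrow> g (Suc m) x - g m x)"

text \<open>After factoring out R n, the bracket is only O(n): the ratio minus 1 is O(1/n) against a
  quadratic q, and the increment of q is linear. This gains the exponent -9/4 + 1 = -5/4, which is
  summable.\<close>

lemma norm_h_Suc_le:
  assumes x: "norm x \<le> 1/40"
  shows "norm (h (Suc n) x) \<le> 43 * K * real (Suc n) powr (- 5/4)"
proof -
  define y where "y = of_nat n + x"
  have y: "norm y \<le> real (Suc n)" unfolding y_def by (rule norm_of_nat_plus_le[OF x])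
  let ?\<rho> = "P y / (of_nat n + 1 + x) ^ 5"
  have "h (Suc n) x = R n x * ((?\<rho> - 1) * q (y + 1) + (q (y + 1) - q y))"
    unfolding h_def g_def R_Suc y_def by (simp add: algebra_simps)
  \<comment> \<open>43 = 40 + 3: the first summand gives 10 * 2^2, as |y + 1| <= 2(n+1), and the
    second gives 3 from 2y + 1.\<close>
  also have "norm \<dots> \<le> real (Suc n) powr (- 9/4) * (43 * K * real (Suc n))"
    unfolding norm_mult
  proof (intro mult_mono norm_R_le x norm_triangle_le)
    have "norm (y + 1) \<le> 2 * real (Suc n)"
      by (rule norm_triangle_le) (use y in auto)
    then have "norm ((?\<rho> - 1) * q (y + 1)) \<le> 10 / (real n + 1) * (K * (2 * real (Suc n))\<^sup>2)"
      unfolding norm_mult y_def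
      by (intro mult_mono norm_P_ratio_diff_1 norm_q_le x) auto
    also have "\<dots> = 40 * K * real (Suc n)" by (simp add: field_simps power2_eq_square)
    finally have 1: "norm ((?\<rho> - 1) * q (y + 1)) \<le> 40 * K * real (Suc n)" .
    have "q (y + 1) - q y = b + c * (2 * y + 1)" by (simp add: q_def algebra_simps power2_eq_square)
    also have "norm \<dots> \<le> norm b * (3 * real (Suc n)) + norm c * (3 * real (Suc n))"
    proof (intro norm_triangle_le add_mono)
      show "norm b \<le> norm b * (3 * real (Suc n))" by (simp add: mult_le_cancel_left1)
      have "norm (2 * y + 1) \<le> 3 * real (Suc n)"
        by (rule norm_triangle_le) (use y in \<open>auto simp: norm_mult\<close>)
      then show "norm (c * (2 * y + 1)) \<le> norm c * (3 * real (Suc n))"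
        unfolding norm_mult by (rule mult_left_mono) auto
    qed
    also have "\<dots> = (norm b + norm c) * (3 * real (Suc n))" by (simp add: algebra_simps)
    also have "\<dots> \<le> K * (3 * real (Suc n))"
      by (rule mult_right_mono) (auto simp: K_def)
    finally have "norm (q (y + 1) - q y) \<le> K * (3 * real (Suc n))" .
    with 1 show "norm ((?\<rho> - 1) * q (y + 1)) + norm (q (y + 1) - q y) \<le> 43 * K * real (Suc n)"
      by (simp add: algebra_simps)
  qed auto
  also have "\<dots> = 43 * K * (real (Suc n) powr (- 9/4) * real (Suc n) powr 1)" by simp
  also have "real (Suc n) powr (- 9/4) * real (Suc n) powr 1 = real (Suc n) powr (- 5/4)"
    by (simp only: powr_add[symmetric]) simp
  finally show ?thesis .
qed

text \<open>Summable majorant of the h n on the closed disc of radius 1/40; index 0 stands apart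
  because \<open>h 0\<close> is \<open>g 0\<close>, not a difference.\<close>

definition M :: "nat \<Rightarrow> real" where
  "M n = (case n of 0 \<Rightarrow> K | Suc m \<Rightarrow> 43 * K * real (Suc m) powr (- 5/4))"

lemma norm_h_le:
  assumes x: "norm x \<le> 1/40"
  shows "norm (h n x) \<le> M n"
proof (cases n)
  case 0
  then show ?thesis using norm_g_le[OF x, of 0] by (simp add: h_def M_def)
next
  case (Suc m)
  then show ?thesis using norm_h_Suc_le[OF x, of m] by (simp add: M_def)
qed

lemma summable_M: "summable M"
proof -
  have "summable (\<lambda>n. real n powr (- 5/4))" by (subst summable_real_powr_iff) simp
  then have "summable (\<lambda>n. real (Suc n) powr (- 5/4))" by (subst summable_Suc_iff)
  then have "summable (\<lambda>n. 43 * K * real (Suc n) powr (- 5/4))" by (rule summable_mult)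
  then have "summable (\<lambda>n. M (Suc n))" by (simp add: M_def)
  then show ?thesis by (subst (asm) summable_Suc_iff)
qed

lemma h_holomorphic: "h n holomorphic_on ball 0 1"
  unfolding h_def by (cases n) (auto intro!: holomorphic_intros g_holomorphic)

lemma h_has_fps_expansion: "h n has_fps_expansion fps_expansion (h n) 0"
  by (rule has_fps_expansion_fps_expansion[of "ball 0 1"]) (auto intro: h_holomorphic)

text \<open>Cauchy's inequality on the circle of radius 1/40 turns the uniform bound into a bound on
  each Taylor coefficient.\<close>

lemma norm_h_coeff_le:
  "norm (fps_nth (fps_expansion (h n) 0) i) \<le> 40 ^ i * M n"
proof -
  have hol: "h n holomorphic_on cball 0 (1/40)"
    by (rule holomorphic_on_subset[OF h_holomorphic]) auto
  have "norm ((deriv ^^ i) (h n) 0) \<le> fact i * M n / (1/40) ^ i"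
  proof (rule Cauchy_inequality)
    show "h n holomorphic_on ball 0 (1/40)"
      by (rule holomorphic_on_subset[OF hol]) auto
    show "continuous_on (cball 0 (1/40)) (h n)"
      by (rule holomorphic_on_imp_continuous_on[OF hol])
  qed (auto intro!: norm_h_le)
  then show ?thesis
    by (simp add: fps_expansion_def norm_divide power_divide field_simps)
qed

definition H :: "complex \<Rightarrow> complex \<Rightarrow> complex" where
  "H z x = (\<Sum>n. z ^ n * h n x)"

section \<open>The summed series for |z| <= 1 and its Taylor coefficients\<close>

context
  fixes z :: complex
  assumes z: "norm z \<le> 1"
begin

lemma norm_z_power_mult_le:
  assumes "norm w \<le> B" shows "norm (z ^ n * w) \<le> B"
proof -
  have "norm (z ^ n * w) \<le> 1 * B"
    unfolding norm_mult norm_power by (intro mult_mono power_le_one z assms) auto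
  then show ?thesis by simp
qed

lemma H_uniform_limit:
  "uniform_limit (cball 0 (1/40)) (\<lambda>N x. \<Sum>n<N. z ^ n * h n x) (H z) sequentially"
  unfolding H_def
  by (rule Weierstrass_m_test[OF _ summable_M])
     (auto intro!: norm_z_power_mult_le norm_h_le)

lemma H_holomorphic: "H z holomorphic_on ball 0 (1/40)"
proof (rule holomorphic_uniform_limit[OF _ H_uniform_limit, THEN conjunct2])
  show "\<forall>\<^sub>F N in sequentially. continuous_on (cball 0 (1/40)) (\<lambda>x. \<Sum>n<N. z ^ n * h n x) \<and>
      (\<lambda>x. \<Sum>n<N. z ^ n * h n x) holomorphic_on ball 0 (1/40)"
  proof (intro always_eventually allI conjI)
    fix N
    have "(\<lambda>x. \<Sum>n<N. z ^ n * h n x) holomorphic_on ball 0 1"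
      by (intro holomorphic_intros h_holomorphic)
    then show "(\<lambda>x. \<Sum>n<N. z ^ n * h n x) holomorphic_on ball 0 (1/40)"
      "continuous_on (cball 0 (1/40)) (\<lambda>x. \<Sum>n<N. z ^ n * h n x)"
      by (auto intro!: holomorphic_on_imp_continuous_on elim!: holomorphic_on_subset)
  qed
qed auto

lemma H_has_fps_expansion: "H z has_fps_expansion fps_expansion (H z) 0"
  by (rule has_fps_expansion_fps_expansion[of "ball 0 (1/40)"]) (auto intro: H_holomorphic)

text \<open>Absolute convergence is what the Cauchy products in \<open>alt_coeff4_H\<close> rest
  on.\<close>

lemma h_coeff_summable: 
  "summable (\<lambda>n. norm (z ^ n * fps_nth (fps_expansion (h n) 0) i))"
proof (rule summable_comparison_test)
  show "summable (\<lambda>n. 40 ^ i * M n)" by (intro summable_mult summable_M)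
  show "\<exists>N. \<forall>n\<ge>N. norm (norm (z ^ n * fps_nth (fps_expansion (h n) 0) i)) \<le> 40 ^ i * M n"
    using norm_z_power_mult_le[OF norm_h_coeff_le] by auto
qed

text \<open>Uniform limits of holomorphic functions commute with derivatives at 0, so Taylor
  coefficients can be summed term by term.\<close>

lemma H_coeff:
  "fps_nth (fps_expansion (H z) 0) i = (\<Sum>n. z ^ n * fps_nth (fps_expansion (h n) 0) i)"
proof -
  let ?S = "\<lambda>N x. \<Sum>n<N. z ^ n * h n x"
  have S: "?S N has_fps_expansion (\<Sum>n<N. fps_const (z ^ n) * fps_expansion (h n) 0)" for N
    by (intro fps_expansion_intros h_has_fps_expansion)
  have "(\<lambda>N. (deriv ^^ i) (?S N) 0) \<longlonglongrightarrow> (deriv ^^ i) (H z) 0"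
  proof (rule higher_deriv_complex_uniform_limit)
    show "uniform_limit (ball 0 (1/40)) ?S (H z) sequentially"
      by (rule uniform_limit_on_subset[OF H_uniform_limit]) auto
    show "\<forall>\<^sub>F N in sequentially. ?S N holomorphic_on ball 0 (1/40)"
      by (intro always_eventually allI holomorphic_intros holomorphic_on_subset[OF h_holomorphic]) auto
  qed auto
  then have "(\<lambda>N. (deriv ^^ i) (?S N) 0 / fact i) \<longlonglongrightarrow> (deriv ^^ i) (H z) 0 / fact i"
    by (intro tendsto_divide tendsto_const) auto
  then have "(\<lambda>N. \<Sum>n<N. z ^ n * fps_nth (fps_expansion (h n) 0) i)
      \<longlonglongrightarrow> fps_nth (fps_expansion (H z) 0) i"
    unfolding fps_nth_fps_expansion[OF S, symmetric]
      fps_nth_fps_expansion[OF H_has_fps_expansion, symmetric]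
    by (simp add: fps_sum_nth)
  then show ?thesis by (simp add: sums_def[symmetric] sums_iff)
qed

text \<open>Summation by parts: the partial sums of z^n h_n are 1 - z times those of z^n g_n plus a
  boundary term z^N g_N, which tends to 0. This includes z = -1.\<close>

lemma g_sums:
  assumes "z \<noteq> 1" and x: "norm x \<le> 1/40"
  shows "(\<lambda>n. z ^ n * g n x) sums (H z x / (1 - z))"
proof -
  have "(\<lambda>n. z ^ n * h n x) sums H z x"
    unfolding H_def
    by (intro summable_sums summable_comparison_test[OF _ summable_M] exI allI impI
        norm_z_power_mult_le norm_h_le x)
  then have "(\<lambda>N. \<Sum>n<Suc N. z ^ n * h n x) \<longlonglongrightarrow> H z x"
    unfolding sums_def by (rule LIMSEQ_Suc)
  moreover have "(\<lambda>N. z ^ N * g N x) \<longlonglongrightarrow> 0"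
    by (rule Lim_null_comparison[OF _ tendsto_norm_zero[OF g_tendsto_0[OF x]]])
       (auto intro!: always_eventually norm_z_power_mult_le)
  moreover have "(\<Sum>n<Suc N. z ^ n * h n x) = (1 - z) * (\<Sum>n<N. z ^ n * g n x) + z ^ N * g N x" for N
  proof (induction N)
    case 0
    show ?case by (simp add: h_def)
  next
    case (Suc N)
    show ?case
      by (subst sum.lessThan_Suc, subst Suc.IH) (simp add: h_def algebra_simps)
  qed
  ultimately have "(\<lambda>N. ((1 - z) * (\<Sum>n<N. z ^ n * g n x) + z ^ N * g N x - z ^ N * g N x) / (1 - z))
      \<longlonglongrightarrow> (H z x - 0) / (1 - z)"
    using assms(1) by (intro tendsto_intros) auto
  then show ?thesis using assms(1) by (simp add: sums_def)
qed

lemma alt_coeff4_H: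
  "alt_coeff4 (fps_expansion (H z) 0) (fps_expansion (H z) 0) = c\<^sup>2 * (1 - z)"
proof -
  \<comment> \<open>The formal variable here marks the index n, not x: the i-th series collects the
    i-th Taylor coefficients of all g n. Passing from g to h multiplies it by 1 - X.\<close>
  define \<Gamma> where "\<Gamma> i = Abs_fps (\<lambda>n. fps_nth (fps_expansion (g n) 0) i)" for i
  have h_coeff: "fps_nth (fps_expansion (h n) 0) i = fps_nth ((1 - fps_X) * \<Gamma> i) n" for n i
  proof (cases n)
    case 0
    then have "h n = g 0" by (simp add: h_def fun_eq_iff)
    then show ?thesis using 0 by (simp add: \<Gamma>_def algebra_simps)
  next
    case (Suc m)
    then have "h n = (\<lambda>x. g (Suc m) x - g m x)" by (simp add: h_def fun_eq_iff)
    moreover have "(\<lambda>x. g (Suc m) x - g m x) has_fps_expansion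
        fps_expansion (g (Suc m)) 0 - fps_expansion (g m) 0"
      by (intro fps_expansion_intros g_has_fps_expansion)
    ultimately have "fps_nth (fps_expansion (h n) 0) i =
        fps_nth (fps_expansion (g (Suc m)) 0 - fps_expansion (g m) 0) i"
      using fps_nth_fps_expansion by (metis h_has_fps_expansion)
    then show ?thesis using Suc by (simp add: \<Gamma>_def algebra_simps)
  qed
  have "fps_nth (\<Sum>i\<le>4. (-1) ^ i * (\<Gamma> i * \<Gamma> (4 - i))) N = c\<^sup>2" for N
  proof -
    have "fps_nth (\<Sum>i\<le>4. (-1) ^ i * (\<Gamma> i * \<Gamma> (4 - i))) N
       = (\<Sum>i\<le>4. (-1) ^ i * fps_nth (\<Gamma> i * \<Gamma> (4 - i)) N)"
      unfolding fps_sum_nth by (rule sum.cong) (auto simp: minus_one_power_iff)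
    also have "\<dots> = (\<Sum>n\<le>N. alt_coeff4 (fps_expansion (g n) 0) (fps_expansion (g (N - n)) 0))"
      unfolding fps_mult_nth alt_coeff4_eq sum_distrib_left atLeast0AtMost
      by (subst sum.swap) (simp add: \<Gamma>_def)
    finally show ?thesis by (simp add: convolution_g)
  qed
  then have \<Gamma>: "(\<Sum>i\<le>4. (-1) ^ i * (\<Gamma> i * \<Gamma> (4 - i))) = Abs_fps (\<lambda>_. c\<^sup>2)"
    by (intro fps_ext) simp
  have geo: "(1 - fps_X) * Abs_fps (\<lambda>_. c\<^sup>2) = fps_const (c\<^sup>2)"
    by (rule fps_ext) (auto simp: algebra_simps)
  \<comment> \<open>The convolution for h in place of g carries the factor (1 - X)^2, so the series
    c^2/(1 - X) becomes the polynomial c^2 (1 - X).\<close>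
  define D where "D N = (\<Sum>n\<le>N. alt_coeff4 (fps_expansion (h n) 0) (fps_expansion (h (N - n)) 0))" for N
  have D_fps: "D N = fps_nth (\<Sum>i\<le>4. (-1) ^ i * (((1 - fps_X) * \<Gamma> i) * ((1 - fps_X) * \<Gamma> (4 - i)))) N" for N
  proof -
    have "D N = (\<Sum>i\<le>4. (-1) ^ i * fps_nth (((1 - fps_X) * \<Gamma> i) * ((1 - fps_X) * \<Gamma> (4 - i))) N)"
      unfolding D_def fps_mult_nth[of "(1 - fps_X) * \<Gamma> _"] alt_coeff4_eq sum_distrib_left atLeast0AtMost
      by (subst sum.swap) (simp only: h_coeff)
    also have "\<dots> = fps_nth (\<Sum>i\<le>4. (-1) ^ i * (((1 - fps_X) * \<Gamma> i) * ((1 - fps_X) * \<Gamma> (4 - i)))) N"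
      unfolding fps_sum_nth by (rule sum.cong) (auto simp: minus_one_power_iff)
    finally show ?thesis .
  qed
  have "(\<Sum>i\<le>4. (-1) ^ i * (((1 - fps_X) * \<Gamma> i) * ((1 - fps_X) * \<Gamma> (4 - i))))
      = (1 - fps_X) * ((1 - fps_X) * (\<Sum>i\<le>4. (-1) ^ i * (\<Gamma> i * \<Gamma> (4 - i))))"
    unfolding sum_distrib_left by (simp only: mult_ac)
  also have "\<dots> = fps_const (c\<^sup>2) * (1 - fps_X)"
    unfolding \<Gamma> geo by (rule mult.commute)
  finally have "D N = fps_nth (fps_const (c\<^sup>2) * (1 - fps_X)) N" for N
    by (simp only: D_fps)
  then have D: "D N = (if N = 0 then c\<^sup>2 else if N = 1 then - c\<^sup>2 else 0)" for N
    by (auto simp: fps_mult_left_const_nth)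
  let ?h = "\<lambda>n i. fps_nth (fps_expansion (h n) 0) i"
  have conv: "(\<Sum>n\<le>N. (z ^ n * ?h n i) * (z ^ (N - n) * ?h (N - n) j))
      = z ^ N * (\<Sum>n\<le>N. ?h n i * ?h (N - n) j)" for N i j
    unfolding sum_distrib_left
  proof (rule sum.cong[OF refl])
    fix n assume "n \<in> {..N}"
    then have "z ^ N = z ^ n * z ^ (N - n)" by (simp flip: power_add)
    then show "(z ^ n * ?h n i) * (z ^ (N - n) * ?h (N - n) j) = z ^ N * (?h n i * ?h (N - n) j)"
      by (simp only: mult_ac)
  qed
  \<comment> \<open>Only now is the formal variable specialised to z.\<close>
  have "(\<lambda>N. z ^ N * (\<Sum>n\<le>N. ?h n i * ?h (N - n) j))
       sums (fps_nth (fps_expansion (H z) 0) i * fps_nth (fps_expansion (H z) 0) j)" for i j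
    unfolding H_coeff conv[symmetric] by (intro Cauchy_product_sums h_coeff_summable)
  then have "(\<lambda>N. \<Sum>i\<le>4. (-1) ^ i * (z ^ N * (\<Sum>n\<le>N. ?h n i * ?h (N - n) (4 - i))))
       sums alt_coeff4 (fps_expansion (H z) 0) (fps_expansion (H z) 0)"
    unfolding alt_coeff4_eq by (intro sums_sum sums_mult)
  moreover have "(\<Sum>i\<le>4. (-1) ^ i * (z ^ N * (\<Sum>n\<le>N. ?h n i * ?h (N - n) (4 - i)))) = z ^ N * D N" for N
    unfolding D_def alt_coeff4_eq by (subst sum.swap) (simp only: sum_distrib_left mult_ac)
  ultimately have "(\<lambda>N. z ^ N * D N) sums alt_coeff4 (fps_expansion (H z) 0) (fps_expansion (H z) 0)"
    by (simp only:)
  moreover have "(\<lambda>N. z ^ N * D N) sums (\<Sum>N\<in>{0, 1}. z ^ N * D N)"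
    by (rule sums_finite) (auto simp: D)
  ultimately have "alt_coeff4 (fps_expansion (H z) 0) (fps_expansion (H z) 0) = (\<Sum>N\<in>{0, 1}. z ^ N * D N)"
    by (rule sums_unique2)
  also have "\<dots> = c\<^sup>2 * (1 - z)" by (simp add: D algebra_simps)
  finally show ?thesis .
qed

end

end

subsection \<open>Comparison of Taylor coefficients\<close>

text \<open>Transfers an O-estimate along the real axis to a complex power series. If n < N were the
  order of vanishing, f would behave like a nonzero multiple of z^n, forcing 1 <= C |x|^(N-n) near
  0, while the right side tends to 0.\<close>

lemma fps_expansion_coeffs_zero_if_bigo_real:
  fixes f :: "complex \<Rightarrow> complex" and d :: "real \<Rightarrow> real"
  assumes f: "f has_fps_expansion F"
    and eq: "\<forall>\<^sub>F x in at 0. f (of_real x) = of_real (d x)"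
    and d: "d \<in> O[at 0](\<lambda>x. x ^ N)"
    and "i < N"
  shows "fps_nth F i = 0"
proof (rule ccontr)
  assume nz: "fps_nth F i \<noteq> 0"
  define n where "n = subdegree F"
  have "n < N" using subdegree_leI[OF nz] \<open>i < N\<close> by (simp add: n_def)
  have "F \<noteq> 0" using nz by auto
  then have Fn: "fps_nth F n \<noteq> 0" by (simp add: n_def)
  have "f \<sim>[nhds 0] (\<lambda>z. fps_nth F n * z ^ n)"
    unfolding n_def by (rule has_fps_expansion_imp_asymp_equiv_0[OF f])
  then have "(\<lambda>z. fps_nth F n * z ^ n) \<in> O[nhds 0](f)"
    by (metis asymp_equiv_symI asymp_equiv_imp_bigo)
  then have "(\<lambda>z. z ^ n) \<in> O[nhds 0](f)" using Fn by simp
  moreover have "filterlim complex_of_real (nhds 0) (at 0)"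
    by (rule tendsto_eq_intros refl | simp)+
  ultimately have "(\<lambda>x. complex_of_real x ^ n) \<in> O[at 0](\<lambda>x. f (of_real x))"
    by (rule landau_o.big.compose)
  also have "(\<lambda>x. f (of_real x)) \<in> O[at 0](\<lambda>x. complex_of_real (d x))"
    by (rule bigoI[of _ 1]) (use eq in \<open>auto elim!: eventually_mono\<close>)
  finally have "(\<lambda>x. x ^ n) \<in> O[at 0](d)"
    by (elim landau_o.bigE) (auto intro!: bigoI simp: norm_power power_abs)
  also note d
  finally obtain C where "\<forall>\<^sub>F x::real in at 0. norm (x ^ n) \<le> C * norm (x ^ N)"
    by (elim landau_o.bigE)
  then have "\<forall>\<^sub>F x::real in at 0. 1 \<le> C * \<bar>x\<bar> ^ (N - n)"
    using eventually_neq_at_within[of 0]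
  proof eventually_elim
    case (elim x)
    have "\<bar>x\<bar> ^ N = \<bar>x\<bar> ^ n * \<bar>x\<bar> ^ (N - n)" using \<open>n < N\<close> by (simp flip: power_add)
    then have "\<bar>x\<bar> ^ n * 1 \<le> \<bar>x\<bar> ^ n * (C * \<bar>x\<bar> ^ (N - n))"
      using elim by (simp add: power_abs mult_ac)
    then show ?case using elim by (simp add: mult_le_cancel_left)
  qed
  moreover have "((\<lambda>x::real. C * \<bar>x\<bar> ^ (N - n)) \<longlongrightarrow> C * \<bar>0\<bar> ^ (N - n)) (at 0)"
    by (intro tendsto_intros)
  ultimately have "1 \<le> C * \<bar>0\<bar> ^ (N - n)"
    by (intro tendsto_lowerbound) auto
  then show False using \<open>n < N\<close> by (simp add: power_0_left)
qed

section \<open>From Gamma quotients to the rational terms\<close>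

lemma gpoch_plus_1:
  assumes "\<alpha> + x > 0"
  shows "gpoch \<alpha> (x + 1) = (\<alpha> + x) * gpoch \<alpha> x"
proof -
  have "Gamma (\<alpha> + x + 1) = (\<alpha> + x) * Gamma (\<alpha> + x)"
    by (rule Gamma_plus1) (use assms nonpos_Ints_nonpos in force)
  then show ?thesis by (simp add: gpoch_def add.assoc)
qed

lemma gpoch_pos: "\<alpha> > 0 \<Longrightarrow> \<alpha> + x > 0 \<Longrightarrow> gpoch \<alpha> x > 0"
  by (simp add: gpoch_def Gamma_real_pos)

lemma isCont_gpoch: "\<alpha> > 0 \<Longrightarrow> isCont (gpoch \<alpha>) 0"
  unfolding gpoch_def by (intro continuous_intros) (auto simp: Gamma_eq_zero_iff elim!: nonpos_Ints_cases)

lemma hyp_coeff_plus_1: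
  assumes "1/2 + x > 0" "s + x > 0" "t + x > 0" "1 - t + x > 0" "1 - s + x > 0"
  shows "hyp_coeff s t (x + 1) = hyp_coeff s t x *
    ((x + 1/2) * (x + s) * (x + t) * (x + 1 - t) * (x + 1 - s) / (x + 1) ^ 5)"
proof -
  have 1: "1 - t + x = x + 1 - t" "1 - s + x = x + 1 - s" by simp_all
  have "1 + x > 0" using assms by linarith
  note eqs = gpoch_plus_1[OF assms(1)] gpoch_plus_1[OF assms(2)] gpoch_plus_1[OF assms(3)]
    gpoch_plus_1[OF assms(4), unfolded 1] gpoch_plus_1[OF assms(5), unfolded 1] gpoch_plus_1[OF this]
  show ?thesis
    unfolding hyp_coeff_def eqs power_mult_distrib
    by (simp add: mult_ac add.commute[of x])
qed

context well_poised_term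
begin

text \<open>Iterates the functional equation of Gamma; the margin on s and t keeps all its arguments
  positive for these x.\<close>

lemma hyp_coeff_add_nat:
  assumes x: "\<bar>x\<bar> \<le> 1/40"
  shows "complex_of_real (hyp_coeff s t (real n + x)) = of_real (hyp_coeff s t x) * R n (of_real x)"
proof (induction n)
  case 0
  show ?case by (simp add: R_def)
next
  case (Suc n)
  have "hyp_coeff s t (real n + x + 1) = hyp_coeff s t (real n + x) *
    ((real n + x + 1/2) * (real n + x + s) * (real n + x + t) * (real n + x + 1 - t) *
     (real n + x + 1 - s) / (real n + x + 1) ^ 5)"
    by (rule hyp_coeff_plus_1) (use x s_bounds t_bounds in linarith)+
  then have "complex_of_real (hyp_coeff s t (real (Suc n) + x)) =
     of_real (hyp_coeff s t (real n + x)) * (P (of_nat n + of_real x) / (of_nat n + 1 + of_real x) ^ 5)"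
    by (simp add: P_def add_ac)
  then show ?case by (simp add: Suc R_Suc)
qed

end

lemma ramanujan_series_eq:
  fixes s t z a b c x :: real
  assumes "well_poised_term s t" and z: "\<bar>z\<bar> \<le> 1" "z \<noteq> 1" and x: "\<bar>x\<bar> \<le> 1/40"
  defines "G \<equiv>
    well_poised_term.H s t (of_real a) (of_real b) (of_real c) (of_real z) (of_real x) / (1 - of_real z)"
  shows "complex_of_real (ramanujan_series s t z a b c x) = of_real (\<bar>z\<bar> powr x * hyp_coeff s t x) * G"
proof -
  interpret well_poised_term s t "complex_of_real a" "complex_of_real b" "complex_of_real c" by fact
  let ?f = "\<lambda>n. z ^ n * hyp_coeff s t (real n + x) * (a + b * (real n + x) + c * (real n + x)\<^sup>2)"
  have "(\<lambda>n. of_real z ^ n * g n (of_real x)) sums G"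
    unfolding G_def by (rule g_sums) (use z x in auto)
  then have "(\<lambda>n. of_real (hyp_coeff s t x) * (of_real z ^ n * g n (of_real x))) sums (of_real (hyp_coeff s t x) * G)"
    by (rule sums_mult)
  also have "(\<lambda>n. of_real (hyp_coeff s t x) * (of_real z ^ n * g n (of_real x))) = (\<lambda>n. complex_of_real (?f n))"
  proof
    fix n
    have "complex_of_real (?f n) =
        of_real z ^ n * (of_real (hyp_coeff s t x) * R n (of_real x)) * q (of_nat n + of_real x)"
      by (simp add: q_def hyp_coeff_add_nat[OF x])
    then show "of_real (hyp_coeff s t x) * (of_real z ^ n * g n (of_real x)) = complex_of_real (?f n)"
      by (simp only: g_def mult_ac)
  qed
  finally have S: "(\<lambda>n. complex_of_real (?f n)) sums (of_real (hyp_coeff s t x) * G)" .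
  \<comment> \<open>Real parts give convergence of the real series itself, so that
    \<open>suminf\<close> denotes its actual sum; the complex sum is then seen to be real.\<close>
  then have Re: "?f sums Re (of_real (hyp_coeff s t x) * G)"
    using sums_Re by fastforce
  have "complex_of_real (Re (of_real (hyp_coeff s t x) * G)) = of_real (hyp_coeff s t x) * G"
    by (rule sums_unique2[OF sums_of_real[OF Re] S])
  then have "complex_of_real (suminf ?f) = of_real (hyp_coeff s t x) * G"
    by (simp only: sums_unique[OF Re, symmetric])
  then show ?thesis by (simp add: ramanujan_series_def mult_ac)
qed

section \<open>Evaluation of tau^2 as c^2 / (1 - z)\<close>

theorem theorem3p11:
  fixes s t z a b c k j m0 m1 m2 m3 m4 :: real
    and \<tau> :: complex
  assumes pair: "(s, t) \<in> admissible_pairs"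
    and z_range: "-1 \<le> z" "z < 1" "z \<noteq> 0"
    and expansion:
      "(\<lambda>x. ramanujan_series s t z a b c x - rhs_poly k j x) \<in> O[at 0](\<lambda>x. x ^ 5)"
    and taylor:
      "(\<lambda>x. m_fun s t z k j x - (m0 + m1 * x + m2 * x\<^sup>2 + m3 * x ^ 3 + m4 * x ^ 4))
         \<in> O[at 0](\<lambda>x. x ^ 5)"
    and tau: "\<tau>\<^sup>2 = of_real (2 * m0 * m4 - 2 * m1 * m3 + m2\<^sup>2)"
    and alg: "algebraic z" "algebraic c"
  shows "algebraic \<tau>"
proof -
  \<comment> \<open>All entries of the admissible pairs lie between 1/12 and 1/2, well inside the
    margin.\<close>
  have wpt: "well_poised_term s t"
    using pair by unfold_locales (auto simp: admissible_pairs_def)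
  interpret well_poised_term s t "complex_of_real a" "complex_of_real b" "complex_of_real c" by (rule wpt)
  define \<zeta> where "\<zeta> = complex_of_real z"
  have z: "\<bar>z\<bar> \<le> 1" "z \<noteq> 1" using z_range by auto
  then have \<zeta>: "norm \<zeta> \<le> 1" "\<zeta> \<noteq> 1" by (auto simp: \<zeta>_def)
  let ?m = "\<lambda>x. m0 + m1 * x + m2 * x\<^sup>2 + m3 * x ^ 3 + m4 * x ^ 4"
  define w where "w x = \<bar>z\<bar> powr (- x) / hyp_coeff s t x" for x
  \<comment> \<open>Since w times \<open>rhs_poly\<close> is \<open>m_fun\<close>, the two errors
    telescope: d is w times the series minus the Taylor polynomial, and w times the series is H / (1
    - z).\<close>
  define d where "d x = w x * (ramanujan_series s t z a b c x - rhs_poly k j x) + (m_fun s t z k j x - ?m x)" for x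
  have hyp_pos: "hyp_coeff s t x > 0" if "\<bar>x\<bar> \<le> 1/40" for x
    unfolding hyp_coeff_def using that s_bounds t_bounds
    by (intro divide_pos_pos mult_pos_pos zero_less_power gpoch_pos) linarith+
  have "isCont (hyp_coeff s t) 0"
    unfolding hyp_coeff_def using s_bounds t_bounds gpoch_pos[of 1 0]
    by (intro continuous_intros isCont_gpoch) auto
  then have "isCont w 0"
    unfolding w_def using hyp_pos[of 0] z_range by (intro continuous_intros) auto
  \<comment> \<open>Multiplication by a factor bounded near 0 preserves the error O(x^5).\<close>
  then have "w \<in> O[at 0](\<lambda>_. 1)"
    by (intro bigoI_tendsto[of _ _ "w 0"]) (auto simp: isCont_def)
  from landau_o.big.mult[OF this expansion]
  have "(\<lambda>x. w x * (ramanujan_series s t z a b c x - rhs_poly k j x)) \<in> O[at 0](\<lambda>x. x ^ 5)"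
    by simp
  from sum_in_bigo(1)[OF this taylor] have d_bigo: "d \<in> O[at 0](\<lambda>x. x ^ 5)"
    unfolding d_def .
  define F where "F = fps_const (1 / (1 - \<zeta>)) * fps_expansion (H \<zeta>) 0"
  define m where "m = fps_const (of_real m0) + fps_const (of_real m1) * fps_X +
      fps_const (of_real m2) * fps_X ^ 2 + fps_const (of_real m3) * fps_X ^ 3 +
      fps_const (complex_of_real m4) * fps_X ^ 4"
  let ?D = "\<lambda>x. 1 / (1 - \<zeta>) * H \<zeta> x -
      (of_real m0 + of_real m1 * x + of_real m2 * x ^ 2 + of_real m3 * x ^ 3 + of_real m4 * x ^ 4)"
  have D: "?D has_fps_expansion (F - m)"
    unfolding F_def m_def by (intro fps_expansion_intros H_has_fps_expansion \<zeta>)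
  have "\<forall>\<^sub>F x::real in at 0. \<bar>x\<bar> < 1/40"
    by (rule eventually_at_topological[THEN iffD2], rule exI[of _ "{-1/40<..<1/40}"]) auto
  then have eq: "\<forall>\<^sub>F x in at 0. ?D (of_real x) = of_real (d x)"
  proof eventually_elim
    case (elim x)
    then have x: "\<bar>x\<bar> \<le> 1/40" by simp
    have "w x * rhs_poly k j x = m_fun s t z k j x"
      by (simp add: w_def m_fun_def hyp_coeff_def)
    then have "d x = w x * ramanujan_series s t z a b c x - ?m x"
      by (simp add: d_def algebra_simps)
    then have "complex_of_real (d x) = of_real (w x) * of_real (ramanujan_series s t z a b c x) - of_real (?m x)"
      by simp
    also have "of_real (w x) * complex_of_real (ramanujan_series s t z a b c x)
       = of_real (w x * (\<bar>z\<bar> powr x * hyp_coeff s t x)) * (H \<zeta> (of_real x) / (1 - \<zeta>))"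
      unfolding ramanujan_series_eq[OF wpt z x] \<zeta>_def by simp
    also have "w x * (\<bar>z\<bar> powr x * hyp_coeff s t x) = 1"
      using hyp_pos[OF x] z_range by (simp add: w_def powr_minus)
    finally show ?case by simp
  qed
  have coeff: "fps_nth F i = fps_nth m i" if "i \<le> 4" for i
    using fps_expansion_coeffs_zero_if_bigo_real[OF D eq d_bigo, of i] that by simp
  have m: "fps_nth m 0 = of_real m0" "fps_nth m 1 = of_real m1" "fps_nth m 2 = of_real m2"
    "fps_nth m 3 = of_real m3" "fps_nth m 4 = of_real m4"
    by (simp_all add: m_def fps_X_power_nth)
  have "alt_coeff4 F F = (1 / (1 - \<zeta>))\<^sup>2 * alt_coeff4 (fps_expansion (H \<zeta>) 0) (fps_expansion (H \<zeta>) 0)"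
    unfolding alt_coeff4_eq F_def fps_mult_left_const_nth
    by (simp add: sum_distrib_left power2_eq_square mult_ac)
  also have "\<dots> = of_real c ^ 2 / (1 - \<zeta>)"
    unfolding alt_coeff4_H[OF \<zeta>(1)] using \<zeta>(2) by (simp add: power2_eq_square)
  also have "\<dots> = of_real (c\<^sup>2 / (1 - z))" by (simp add: \<zeta>_def)
  \<comment> \<open>Only coefficients of index at most 4 enter, and O(x^5) determines exactly
    these.\<close>
  also have "alt_coeff4 F F = alt_coeff4 m m"
    unfolding alt_coeff4_eq by (intro sum.cong) (auto simp: coeff)
  also have "alt_coeff4 m m = \<tau>\<^sup>2"
    unfolding alt_coeff4_eq tau using m
    by (simp add: numeral_eq_Suc)
  finally have "\<tau>\<^sup>2 = of_real (c * c * inverse (1 - z))"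
    by (simp add: power2_eq_square divide_inverse)
  moreover have "algebraic (c * c * inverse (1 - z))"
    using alg by (intro algebraic_mult algebraic_inverse algebraic_one_minus)
  ultimately have "algebraic (\<tau>\<^sup>2)" by (simp only: algebraic_of_real_iff)
  then show ?thesis
    by (rule algebraic_root[where p = "monom 1 2"]) (auto simp: poly_monom degree_monom_eq)
qed

end
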